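(* For every integer $K$, every integer $m\ge2$ and every integer $n$ with $0\le n\le \pi_K(m)$, $F_{K,\pi_K(m)-n}\equiv (-1)^{n+1}F_{K,n}\pmod m$.
   Context: For an integer $K$, the $K$-Fibonacci sequence is $F_{K,0}=0$, $F_{K,1}=1$, $F_{K,n}=KF_{K,n-1}+F_{K,n-2}$ for $n\ge2$. For an integer $m\ge 2$, $\pi_K(m)$ is the least positive period of the sequence $(F_{K,n}\bmod m)$. *)

theory Defs
  imports "HOL-Number_Theory.Cong"
begin

fun kfib :: "int \<Rightarrow> nat \<Rightarrow> int" where
  "kfib K 0 = 0"
| "kfib K (Suc 0) = 1"
| "kfib K (Suc (Suc n)) = K * kfib K (Suc n) + kfib K n"

(* Periods are taken from index 0 on (not merely eventually). The recurrence can be run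
   backwards modulo m, so for m \<ge> 2 such a period exists and LEAST is meaningful. *)
definition kfib_period :: "int \<Rightarrow> int \<Rightarrow> nat" where
  "kfib_period K m =
     (LEAST p. 0 < p \<and> (\<forall>i. kfib K (i + p) mod m = kfib K i mod m))"

end

theory Submission
  imports Defs
begin

text \<open>At a period \<open>p\<close> the consecutive pair of residues at \<open>p\<close>,
  \<open>p + 1\<close> is again (0, 1). Running the recurrence backwards from there gives the same
  values as running it backwards from index 0, namely the negative-index values
  \<open>(-1) ^ (n + 1) * kfib K n\<close>; \<open>kfib_reflect_cong\<close> is this induction. That
  \<open>kfib_period\<close> really is a period comes from pigeonhole on pairs of residues.\<close>

text \<open>The coefficient of the older term is 1, so a pair determines its predecessor modulo
  \<open>m\<close> and a repetition descends to index 0.\<close>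

lemma kfib_backward_cong:
  assumes "[kfib K (i + d) = kfib K i] (mod m)"
    and "[kfib K (Suc i + d) = kfib K (Suc i)] (mod m)"
  shows "[kfib K d = 0] (mod m) \<and> [kfib K (Suc d) = 1] (mod m)"
  using assms
proof (induction i)
  case 0
  then show ?case by simp
next
  case (Suc i)
  have "[kfib K (Suc (Suc i) + d) - K * kfib K (Suc i + d)
       = kfib K (Suc (Suc i)) - K * kfib K (Suc i)] (mod m)"
    by (intro cong_diff cong_scalar_left Suc.prems)
  then have "[kfib K (i + d) = kfib K i] (mod m)"
    by simp
  then show ?case
    using Suc.prems(1) by (rule Suc.IH)
qed

lemma kfib_forward_cong:
  assumes "[kfib K d = 0] (mod m)" and "[kfib K (Suc d) = 1] (mod m)"
  shows "[kfib K (i + d) = kfib K i] (mod m)"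
  using assms
proof (induction K i rule: kfib.induct)
  case (3 K i)
  have "[K * kfib K (Suc i + d) + kfib K (i + d) = K * kfib K (Suc i) + kfib K i] (mod m)"
    using 3 by (intro cong_add cong_scalar_left) auto
  then show ?case by simp
qed simp_all

text \<open>Only finitely many pairs of consecutive residues exist, so two coincide; their distance
  is a period.\<close>

lemma kfib_period_exists:
  fixes K m :: int
  assumes "m > 0"
  shows "\<exists>p>0. \<forall>i. kfib K (i + p) mod m = kfib K i mod m"
proof -
  define g where "g i = (kfib K i mod m, kfib K (Suc i) mod m)" for i
  have "range g \<subseteq> {0..<m} \<times> {0..<m}"
    using assms by (auto simp: g_def)
  then have "finite (range g)"
    by (rule finite_subset) simp
  then have "\<not> inj g"
    using finite_imageD by blast
  then obtain i j where "i < j" "g i = g j"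
    unfolding inj_def by (metis linorder_neqE_nat)
  then obtain d where "d > 0" and j: "j = i + d"
    using less_imp_add_positive by blast
  have "[kfib K (i + d) = kfib K i] (mod m)" "[kfib K (Suc i + d) = kfib K (Suc i)] (mod m)"
    using \<open>g i = g j\<close> unfolding j g_def cong_def by (simp_all del: kfib.simps)
  \<comment> \<open>Descending to the initial pair makes the sequence periodic from index 0, not
    just from \<open>i\<close> on.\<close>
  from kfib_backward_cong[OF this] have "\<forall>i. kfib K (i + d) mod m = kfib K i mod m"
    using kfib_forward_cong unfolding cong_def by blast
  with \<open>d > 0\<close> show ?thesis by blast
qed

lemma kfib_add_period_cong:
  assumes "m > 0"
  shows "[kfib K (i + kfib_period K m) = kfib K i] (mod m)"
  using LeastI_ex[OF kfib_period_exists[OF assms, of K]]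
  unfolding kfib_period_def cong_def by blast

lemma kfib_reflect_cong:
  assumes "[kfib K p = 0] (mod m)" and "[kfib K (Suc p) = 1] (mod m)" and "n \<le> p"
  shows "[kfib K (p - n) = (-1) ^ (n + 1) * kfib K n] (mod m)"
  using assms
proof (induction K n rule: kfib.induct)
  case (2 K)
  then obtain q where p: "p = Suc q"
    by (cases p) auto
  \<comment> \<open>The left side is the term before index \<open>p\<close>, which exists since 1
    \<le> \<open>p\<close>.\<close>
  have "[kfib K (Suc p) - K * kfib K p = 1 - K * 0] (mod m)"
    by (intro cong_diff cong_scalar_left 2)
  then show ?case by (simp add: p)
next
  case (3 K n)
  define q where "q = p - Suc (Suc n)"
  have q: "p - n = Suc (Suc q)" "p - Suc n = Suc q"
    using 3 by (auto simp: q_def)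
  \<comment> \<open>The left side is \<open>kfib K q\<close>; on the right the alternating sign
    turns the difference into
    \<open>(-1) ^ (n + 1) * (kfib K n + K * kfib K (Suc n))\<close>.\<close>
  have "[kfib K (p - n) - K * kfib K (p - Suc n)
       = (-1) ^ (n + 1) * kfib K n - K * ((-1) ^ (Suc n + 1) * kfib K (Suc n))] (mod m)"
    using 3 by (intro cong_diff cong_scalar_left) auto
  then show ?case
    unfolding q_def[symmetric] q by (simp add: algebra_simps)
qed simp

theorem theorem4p13:
  fixes K m :: int and n :: nat
  assumes "m \<ge> 2"
    and "n \<le> kfib_period K m"
  shows "[kfib K (kfib_period K m - n) = (-1) ^ (n + 1) * kfib K n] (mod m)"
proof (rule kfib_reflect_cong)
  have "m > 0" using assms by simp
  from kfib_add_period_cong[OF this, of K 0] kfib_add_period_cong[OF this, of K 1]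
  show "[kfib K (kfib_period K m) = 0] (mod m)" "[kfib K (Suc (kfib_period K m)) = 1] (mod m)"
    by simp_all
qed (fact assms)

end
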